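(* Under bilateral link formation with the simple-minded adversary and pairwise stability as equilibrium concept, the price of anarchy is $O\big(1+\sqrt{n/\alpha}\big)$ if $\alpha>\frac12$ and $O\big(1+\sqrt{n/\alpha^{1.5}}\big)$ otherwise. That is, there is an absolute constant $c>0$ such that for all integers $n\ge 3$, all $\alpha>0$ and every pairwise stable strategy profile $S$ for $n$ players and link cost $\alpha$, $$\frac{C(S)}{\mathrm{OPT}(n,\alpha)}\le c\Big(1+\sqrt{n/\alpha}\Big)\ \text{ if }\alpha>\tfrac12,\qquad \frac{C(S)}{\mathrm{OPT}(n,\alpha)}\le c\Big(1+\sqrt{n/\alpha^{1.5}}\Big)\ \text{ if }\alpha\le\tfrac12 .$$
   Context: Players are $V=\{1,\dots,n\}$ ($n\ge 3$), link cost is $\alpha>0$. A strategy profile is a matrix $S\in\{0,1\}^{n\times n}$ with $S_{vv}=0$; for $v\ne w$, $S_{vw}=1$ means that player $v$ requests the edge $\{v,w\}$. Bilateral link formation: the final graph is the simple undirected graph $G(S)=(V,E(S))$ with $E(S)=\{\{v,w\}: S_{vw}=1 \text{ and } S_{wv}=1\}$. Optima and equilibria are taken among essential profiles only ($S_{vw}=1\Rightarrow S_{wv}=1$), so an equilibrium is determined by its final graph. $S+(v,w)$, $S-(v,w)$ denote $S$ with the entry $S_{vw}$ set to $1$, respectively $0$. For a connected graph $G=(V,E)$, $e\in E$, $v\in V$, the relevance $\mathrm{rel}_G(e,v)$ is the number of vertices that, starting at $v$, can only be reached via $e$ (so it is $0$ iff $e$ is not a bridge). The simple-minded adversary removes one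 edge chosen uniformly at random; so the disconnection cost of $v$ is $I_v(G)=\frac{1}{|E|}\sum_{e\in E}\mathrm{rel}_G(e,v)$ if $G$ is connected and $I_v(G)=\infty$ otherwise. Individual cost: $C_v(S)=\alpha\sum_{w}S_{vw}+I_v(G(S))$. Social cost: $C(S)=\sum_{v}C_v(S)$ ($=2\alpha|E(S)|+\sum_v I_v(G(S))$ for essential $S$). $\mathrm{OPT}(n,\alpha)$ is the minimum social cost. $S$ is pairwise stable if (a) for all $\{v,w\}\in E(S)$: $C_v(S-(v,w))\ge C_v(S)$ and $C_w(S-(w,v))\ge C_w(S)$; and (b) for all $v\ne w$ with $\{v,w\}\notin E(S)$: if $C_v(S+(v,w)+(w,v))\le C_v(S)$ then $C_w(S+(v,w)+(w,v))>C_w(S)$. (By (b), pairwise stable profiles have connected final graphs.) *)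

theory Defs
  imports Complex_Main "HOL-Library.Extended_Real"
begin

subsection \<open>Relevance and disconnection cost in a simple graph\<close>

text \<open>A graph is given by its vertex set and its set of edges, which are two-element sets of vertices.\<close>

definition walk_edges :: "'a list \<Rightarrow> 'a set set" where
  "walk_edges xs = {{xs ! i, xs ! Suc i} | i. Suc i < length xs}"

definition walk_betw :: "'a set \<Rightarrow> 'a set set \<Rightarrow> 'a \<Rightarrow> 'a list \<Rightarrow> 'a \<Rightarrow> bool" where
  "walk_betw V E v xs w \<longleftrightarrow>
     xs \<noteq> [] \<and> hd xs = v \<and> last xs = w \<and> set xs \<subseteq> V \<and> walk_edges xs \<subseteq> E"

definition connected_graph :: "'a set \<Rightarrow> 'a set set \<Rightarrow> bool" where
  "connected_graph V E \<longleftrightarrow> (\<forall>v\<in>V. \<forall>w\<in>V. \<exists>xs. walk_betw V E v xs w)"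

definition relevance :: "'a set \<Rightarrow> 'a set set \<Rightarrow> 'a set \<Rightarrow> 'a \<Rightarrow> nat" where
  "relevance V E e v = card {w \<in> V. \<forall>xs. walk_betw V E v xs w \<longrightarrow> e \<in> walk_edges xs}"

text \<open>The expected number of vertices that \<open>v\<close> can no longer reach after the simple-minded
  adversary has removed one edge chosen uniformly at random.\<close>

definition disconnection_cost :: "'a set \<Rightarrow> 'a set set \<Rightarrow> 'a \<Rightarrow> ereal" where
  "disconnection_cost V E v =
     (if connected_graph V E
      then ereal (1 / real (card E) * (\<Sum>e\<in>E. real (relevance V E e v)))
      else \<infinity>)"


subsection \<open>Bilateral link formation\<close>

text \<open>The entry \<open>S v w\<close> is true iff \<open>v\<close> requests the edge between \<open>v\<close> and \<open>w\<close>.\<close>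

type_synonym profile = "nat \<Rightarrow> nat \<Rightarrow> bool"

definition players :: "nat \<Rightarrow> nat set" where
  "players n = {1..n}"

text \<open>Entries outside the \<open>n \<times> n\<close> matrix are required to be false, so that there are only finitely
  many profiles for each \<open>n\<close>.\<close>

definition strategy_profile :: "nat \<Rightarrow> profile \<Rightarrow> bool" where
  "strategy_profile n S \<longleftrightarrow> (\<forall>v w. S v w \<longrightarrow> v \<in> players n \<and> w \<in> players n \<and> v \<noteq> w)"

definition essential :: "profile \<Rightarrow> bool" where
  "essential S \<longleftrightarrow> (\<forall>v w. S v w \<longrightarrow> S w v)"

definition add_request :: "profile \<Rightarrow> nat \<Rightarrow> nat \<Rightarrow> profile" where
  "add_request S v w = S(v := (S v)(w := True))"

definition del_request :: "profile \<Rightarrow> nat \<Rightarrow> nat \<Rightarrow> profile" where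
  "del_request S v w = S(v := (S v)(w := False))"

definition final_edges :: "profile \<Rightarrow> nat set set" where
  "final_edges S = {{v, w} | v w. S v w \<and> S w v}"

definition individual_cost :: "nat \<Rightarrow> real \<Rightarrow> profile \<Rightarrow> nat \<Rightarrow> ereal" where
  "individual_cost n \<alpha> S v =
     ereal (\<alpha> * (\<Sum>w\<in>players n. of_bool (S v w))) + disconnection_cost (players n) (final_edges S) v"

definition social_cost :: "nat \<Rightarrow> real \<Rightarrow> profile \<Rightarrow> ereal" where
  "social_cost n \<alpha> S = (\<Sum>v\<in>players n. individual_cost n \<alpha> S v)"

definition optimal_cost :: "nat \<Rightarrow> real \<Rightarrow> ereal" where
  "optimal_cost n \<alpha> = Min {social_cost n \<alpha> S | S. strategy_profile n S \<and> essential S}"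

definition pairwise_stable :: "nat \<Rightarrow> real \<Rightarrow> profile \<Rightarrow> bool" where
  "pairwise_stable n \<alpha> S \<longleftrightarrow>
     strategy_profile n S \<and> essential S \<and>
     (\<forall>v\<in>players n. \<forall>w\<in>players n. {v, w} \<in> final_edges S \<longrightarrow>
        individual_cost n \<alpha> (del_request S v w) v \<ge> individual_cost n \<alpha> S v \<and>
        individual_cost n \<alpha> (del_request S w v) w \<ge> individual_cost n \<alpha> S w) \<and>
     (\<forall>v\<in>players n. \<forall>w\<in>players n. v \<noteq> w \<and> {v, w} \<notin> final_edges S \<longrightarrow>
        individual_cost n \<alpha> (add_request (add_request S v w) w v) v \<le> individual_cost n \<alpha> S v \<longrightarrow>
        individual_cost n \<alpha> (add_request (add_request S v w) w v) w > individual_cost n \<alpha> S w)"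

text \<open>The set whose minimum is the optimal cost is finite and nonempty, so \<^const>\<open>Min\<close> is meaningful.\<close>

lemma finite_strategy_profiles: "finite {S. strategy_profile n S}"
proof (rule finite_imageD)
  let ?f = "\<lambda>S::profile. {(v, w). S v w}"
  have "?f ` {S. strategy_profile n S} \<subseteq> Pow (players n \<times> players n)"
    by (auto simp: strategy_profile_def)
  then show "finite (?f ` {S. strategy_profile n S})"
    by (rule finite_subset) (simp add: players_def)
  show "inj_on ?f {S. strategy_profile n S}"
    by (rule inj_onI) (auto simp: fun_eq_iff set_eq_iff)
qed

lemma finite_social_costs:
  "finite {social_cost n \<alpha> S | S. strategy_profile n S \<and> essential S}"
  by (rule finite_subset[OF _ finite_imageI[OF finite_strategy_profiles[of n]]]) auto

lemma social_costs_nonempty: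
  "{social_cost n \<alpha> S | S. strategy_profile n S \<and> essential S} \<noteq> {}"
proof -
  have "strategy_profile n (\<lambda>v w. False) \<and> essential (\<lambda>v w. False)"
    by (simp add: strategy_profile_def essential_def)
  then show ?thesis by blast
qed

end

theory Submission
  imports Defs
begin

text \<open>
  Since an optimal profile is connected, it costs at least \<open>\<alpha> n\<close>, so the cost of a stable profile with
  \<open>m\<close> edges has to be compared with \<open>\<alpha> n\<close>. The relevances at \<open>v\<close> add up to \<open>\<Sum>w. d(v, w)\<close>, where
  \<open>d(v, w)\<close> is the number of bridges separating \<open>v\<close> from \<open>w\<close>.

  Adding the edge \<open>{v, w}\<close> removes relevances \<open>\<ge> 1 + 2 + \<dots> + d(v, w)\<close> for both endpoints, so stability
  against additions forces \<open>d(v, w)\<^sup>2 \<le> 2 \<alpha> m\<close>. As \<open>m \<ge> n / 2\<close>, the total disconnection cost is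
  at most \<open>n\<^sup>2 sqrt (2 \<alpha> / m) = O(\<alpha> n sqrt (n / \<alpha>))\<close>.

  For the number of edges, fix a spanning tree \<open>T\<close>. If the removal of every edge \<open>e\<close> outside \<open>T\<close> creates
  a new bridge \<open>f\<close>, then \<open>e \<mapsto> f\<close> is an injection into \<open>T\<close> and \<open>m \<le> 2 n\<close>. Otherwise the removal of
  some \<open>e = {v, w}\<close> does not increase any relevance at \<open>v\<close>, only the probability \<open>1 / m\<close> with which each
  edge is hit; stability against removals then gives \<open>\<alpha> m (m - 1) \<le> n sqrt (2 \<alpha> m)\<close>, that is
  \<open>\<alpha> m\<^sup>3 = O(n\<^sup>2)\<close>.
\<close>

definition adj :: "'a set set \<Rightarrow> ('a \<times> 'a) set" where
  "adj E = {(x, y). {x, y} \<in> E}"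

text \<open>Replaces \<open>walk_betw\<close> by a reflexive transitive closure; the vertex set
  disappears because the edges of a graph on \<open>V\<close> never leave \<open>V\<close>.\<close>

abbreviation reach :: "'a set set \<Rightarrow> 'a \<Rightarrow> 'a \<Rightarrow> bool" where
  "reach E x y \<equiv> (x, y) \<in> (adj E)\<^sup>*"

definition connects :: "'a set set \<Rightarrow> 'a set \<Rightarrow> bool" where
  "connects E V \<longleftrightarrow> (\<forall>v\<in>V. \<forall>w\<in>V. reach E v w)"

definition graph_on :: "'a set \<Rightarrow> 'a set set \<Rightarrow> bool" where
  "graph_on V E \<longleftrightarrow> finite V \<and> (\<forall>e\<in>E. \<exists>x\<in>V. \<exists>y\<in>V. x \<noteq> y \<and> e = {x, y})"

text \<open>For connected \<open>v\<close> and \<open>w\<close> these are the bridges between them,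
  for unconnected ones all edges of \<open>E\<close>. Their number is the \<open>d(v, w)\<close> of
  the overview.\<close>

definition separators :: "'a set set \<Rightarrow> 'a \<Rightarrow> 'a \<Rightarrow> 'a set set" where
  "separators E v w = {f \<in> E. \<not> reach (E - {f}) v w}"

text \<open>Counts by target vertex what the relevances at \<open>v\<close> count by edge, see
  \<open>sum_relevance\<close>.\<close>

definition total_relevance :: "'a set \<Rightarrow> 'a set set \<Rightarrow> 'a \<Rightarrow> nat" where
  "total_relevance V E v = (\<Sum>w\<in>V. card (separators E v w))"


subsection \<open>Reachability\<close>

lemma adj_iff [simp]: "(x, y) \<in> adj E \<longleftrightarrow> {x, y} \<in> E"
  by (simp add: adj_def)

lemma reach_sym: "reach E x y \<Longrightarrow> reach E y x"
proof -
  have "sym (adj E)" by (rule symI) (simp add: insert_commute)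
  then have "sym ((adj E)\<^sup>*)" by (rule sym_rtrancl)
  then show "reach E x y \<Longrightarrow> reach E y x" by (rule symD)
qed

lemma reach_mono: "reach E x y \<Longrightarrow> E \<subseteq> F \<Longrightarrow> reach F x y"
  by (rule rtrancl_mono[THEN subsetD]) (auto simp: adj_def)

lemma reach_edge: "{x, y} \<in> E \<Longrightarrow> reach E x y"
  by (simp add: r_into_rtrancl)

lemma connects_mono: "connects E V \<Longrightarrow> E \<subseteq> F \<Longrightarrow> connects F V"
  unfolding connects_def by (meson reach_mono)

text \<open>A path using the additional edge can take a detour through \<open>E\<close>
  instead.\<close>

lemma reach_insert_redundant:
  assumes "reach (insert {x, y} E) a b" "reach E x y"
  shows "reach E a b"
  using assms(1)
proof (induction rule: rtrancl_induct)
  case (step b c)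
  then consider "{b, c} \<in> E" | "{b, c} = {x, y}" by auto
  then have "reach E b c"
    using assms(2) reach_sym by cases (auto simp: doubleton_eq_iff intro: reach_edge)
  then show ?case using step.IH by (rule rtrancl_trans[rotated])
qed simp

lemma graph_on_subset: "graph_on V E \<Longrightarrow> F \<subseteq> E \<Longrightarrow> graph_on V F"
  unfolding graph_on_def by blast

lemma graph_on_finite: "graph_on V E \<Longrightarrow> finite E"
  by (rule finite_subset[of _ "Pow V"]) (auto simp: graph_on_def)

lemma graph_on_edge: "graph_on V E \<Longrightarrow> {x, y} \<in> E \<Longrightarrow> x \<in> V \<and> y \<in> V \<and> x \<noteq> y"
  unfolding graph_on_def by (metis doubleton_eq_iff)

lemma graph_on_edgeE:
  assumes "graph_on V E" "e \<in> E"
  obtains x y where "x \<in> V" "y \<in> V" "x \<noteq> y" "e = {x, y}"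
  using assms unfolding graph_on_def by blast

text \<open>"At most two components remain", expressed for three arbitrary vertices.\<close>

lemma reach_after_removal:
  assumes "graph_on V E" "connects E V" "a \<in> V" "b \<in> V" "c \<in> V"
  shows "reach (E - {f}) a b \<or> reach (E - {f}) a c \<or> reach (E - {f}) b c"
proof (cases "f \<in> E")
  case True
  then obtain p q where pq: "p \<in> V" "q \<in> V" "f = {p, q}"
    using graph_on_edgeE[OF assms(1)] by metis
  have *: "reach (E - {f}) u p \<or> reach (E - {f}) u q" if "u \<in> V" for u
  proof -
    have "reach E u p" using assms(2) that pq by (simp add: connects_def)
    then show ?thesis
    proof (induction rule: converse_rtrancl_induct)
      case (step x y)
      show ?case
      proof (cases "{x, y} = f")
        case True
        then show ?thesis using pq by (auto simp: doubleton_eq_iff)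
      next
        case False
        then have "reach (E - {f}) x y" using step.hyps by (intro reach_edge) auto
        then show ?thesis using step.IH by (meson rtrancl_trans)
      qed
    qed simp
  qed
  \<comment> \<open>Pigeonhole: two of the three vertices reach the same endpoint of
    \<open>f\<close>.\<close>
  show ?thesis
    using *[OF assms(3)] *[OF assms(4)] *[OF assms(5)] by (meson reach_sym rtrancl_trans)
next
  case False
  then show ?thesis using assms by (simp add: connects_def)
qed

text \<open>The exchange property of spanning trees, here for any connecting \<open>T\<close>:
  removing \<open>f\<close> leaves two components with \<open>x\<close> and \<open>y\<close> on
  different sides, and the edge between them joins the components again.\<close>

lemma connects_exchange:
  assumes "graph_on V T" "connects T V" "x \<in> V" "y \<in> V" "\<not> reach (T - {f}) x y"
  shows "connects (insert {x, y} (T - {f})) V"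
proof -
  let ?U = "insert {x, y} (T - {f})"
  have mono: "reach ?U a b" if "reach (T - {f}) a b" for a b
    using that by (rule reach_mono) auto
  have xy: "reach ?U x y" by (simp add: reach_edge)
  have "reach ?U a x" if "a \<in> V" for a
    using reach_after_removal[OF assms(1,2) that assms(3,4), of f] assms(5) mono xy
    by (meson reach_sym rtrancl_trans)
  then show ?thesis unfolding connects_def by (meson reach_sym rtrancl_trans)
qed


subsection \<open>Disconnection cost via separating edges\<close>

lemma walk_edges_Cons_Cons:
  "walk_edges (x # y # xs) = insert {x, y} (walk_edges (y # xs))"
proof -
  have "walk_edges (x # y # xs) = (\<lambda>i. {(x # y # xs) ! i, (x # y # xs) ! Suc i}) ` {..<Suc (length xs)}"
    by (auto simp: walk_edges_def)
  also have "\<dots> = insert {x, y} (walk_edges (y # xs))"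
    unfolding lessThan_Suc_eq_insert_0 by (auto simp: walk_edges_def image_image)
  finally show ?thesis .
qed

lemma walk_imp_reach:
  assumes "xs \<noteq> []" "walk_edges xs \<subseteq> E"
  shows "reach E (hd xs) (last xs)"
  using assms
proof (induction xs rule: induct_list012)
  case (3 x y zs)
  then have "reach E x y" "reach E y (last (y # zs))"
    by (auto simp: walk_edges_Cons_Cons intro: reach_edge)
  then show ?case by simp
qed auto

lemma ex_walk_iff_reach:
  assumes "graph_on V E" "v \<in> V"
  shows "(\<exists>xs. walk_betw V E v xs w) \<longleftrightarrow> reach E v w"
proof
  assume "\<exists>xs. walk_betw V E v xs w"
  then show "reach E v w" unfolding walk_betw_def using walk_imp_reach by blast
next
  assume "reach E v w"
  then show "\<exists>xs. walk_betw V E v xs w" using assms(2)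
  proof (induction rule: converse_rtrancl_induct)
    case base
    then have "walk_betw V E w [w] w" by (simp add: walk_betw_def walk_edges_def)
    then show ?case ..
  next
    case (step x y)
    have "y \<in> V" using step.hyps graph_on_edge[OF assms(1)] by auto
    then obtain xs where "walk_betw V E y xs w" using step.IH by auto
    moreover from this obtain ys where "xs = y # ys"
      by (cases xs) (auto simp: walk_betw_def)
    ultimately have "walk_betw V E x (x # xs) w"
      using step by (auto simp: walk_betw_def walk_edges_Cons_Cons)
    then show ?case ..
  qed
qed

lemma connected_graph_iff: "graph_on V E \<Longrightarrow> connected_graph V E \<longleftrightarrow> connects E V"
  by (simp add: connected_graph_def connects_def ex_walk_iff_reach)

text \<open>The walks that avoid \<open>e\<close> are exactly the walks of
  \<open>E - {e}\<close>.\<close>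

lemma relevance_eq:
  assumes "graph_on V E" "v \<in> V"
  shows "relevance V E e v = card {w \<in> V. \<not> reach (E - {e}) v w}"
proof -
  have "(\<forall>xs. walk_betw V E v xs w \<longrightarrow> e \<in> walk_edges xs) \<longleftrightarrow>
      \<not> (\<exists>xs. walk_betw V (E - {e}) v xs w)" for w
    by (auto simp: walk_betw_def)
  then show ?thesis
    using ex_walk_iff_reach[OF graph_on_subset[OF assms(1)] assms(2), of "E - {e}"]
    by (simp add: relevance_def)
qed

text \<open>Double counting of the pairs of an edge and a vertex that it cuts off from
  \<open>v\<close>.\<close>

lemma sum_relevance:
  assumes "graph_on V E" "v \<in> V"
  shows "(\<Sum>e\<in>E. relevance V E e v) = total_relevance V E v"
proof -
  have fin: "finite V" "finite E"
    using assms graph_on_finite by (auto simp: graph_on_def)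
  have "(\<Sum>e\<in>E. relevance V E e v) = (\<Sum>e\<in>E. \<Sum>w\<in>V. of_bool (\<not> reach (E - {e}) v w))"
    using fin by (simp add: relevance_eq[OF assms] Int_def)
  also have "\<dots> = (\<Sum>w\<in>V. \<Sum>e\<in>E. of_bool (\<not> reach (E - {e}) v w))"
    by (rule sum.swap)
  also have "\<dots> = total_relevance V E v"
    using fin by (simp add: total_relevance_def separators_def Int_def)
  finally show ?thesis .
qed

lemma disconnection_cost_connected:
  assumes "graph_on V E" "connects E V" "v \<in> V"
  shows "disconnection_cost V E v = ereal (total_relevance V E v / card E)"
  using assms sum_relevance[OF assms(1,3)]
  by (simp add: disconnection_cost_def connected_graph_iff flip: of_nat_sum)

lemma disconnection_cost_disconnected:
  "graph_on V E \<Longrightarrow> \<not> connects E V \<Longrightarrow> disconnection_cost V E v = \<infinity>"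
  by (simp add: disconnection_cost_def connected_graph_iff)


subsection \<open>Adding an edge\<close>

lemma separators_sym: "separators E v w = separators E w v"
proof -
  have "reach F v w \<longleftrightarrow> reach F w v" for F using reach_sym[of v w F] reach_sym[of w v F] by auto
  then show ?thesis by (simp add: separators_def)
qed

lemma separators_edge: "{v, w} \<in> E \<Longrightarrow> separators E v w \<subseteq> {{v, w}}"
  using reach_edge[of v w] by (fastforce simp: separators_def)

lemma separators_self: "separators E v v = {}"
  by (simp add: separators_def)

text \<open>A new edge destroys no path, and it separates nothing itself, since \<open>E\<close>
  alone already joins \<open>v\<close> to \<open>u\<close>.\<close>

lemma separators_insert_subset:
  "connects E V \<Longrightarrow> v \<in> V \<Longrightarrow> u \<in> V \<Longrightarrow> separators (insert e E) v u \<subseteq> separators E v u"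
proof
  fix f assume *: "connects E V" "v \<in> V" "u \<in> V" "f \<in> separators (insert e E) v u"
  then have nr: "\<not> reach (insert e E - {f}) v u" by (simp add: separators_def)
  have "f \<in> E"
  proof (rule ccontr)
    assume "f \<notin> E"
    then have "E \<subseteq> insert e E - {f}" by auto
    moreover have "reach E v u" using * by (simp add: connects_def)
    ultimately show False using nr by (metis reach_mono)
  qed
  moreover have "\<not> reach (E - {f}) v u"
    using nr reach_mono[of v u "E - {f}" "insert e E - {f}"] by auto
  ultimately show "f \<in> separators E v u" by (simp add: separators_def)
qed

text \<open>Removing a separator of \<open>v\<close> and \<open>w\<close> leaves two components,
  which the new edge joins; so it no longer separates any pair.\<close>

lemma separators_insert_disjoint:
  assumes "graph_on V E" "connects E V" "v \<in> V" "w \<in> V" "u \<in> V" "{v, w} \<notin> E"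
  shows "separators (insert {v, w} E) v u \<inter> separators E v w = {}"
proof -
  have "reach (insert {v, w} E - {f}) v u" if "f \<in> separators E v w" for f
  proof -
    have "f \<in> E" "\<not> reach (E - {f}) v w" using that by (auto simp: separators_def)
    moreover from this have "insert {v, w} E - {f} = insert {v, w} (E - {f})"
      using assms(6) by auto
    ultimately show ?thesis
      using connects_exchange[OF assms(1-4)] assms(3,5) by (auto simp: connects_def)
  qed
  then show ?thesis by (auto simp: separators_def)
qed

text \<open>Along a walk from \<open>v\<close> to \<open>u\<close> the number of edges of \<open>F\<close> separating the current vertex from
  \<open>v\<close> changes by at most one per step, so it takes all intermediate values.\<close>

lemma separators_intermediate:
  assumes "graph_on V E" "v \<in> V" "reach E v u" "j \<le> card (separators E v u \<inter> F)"
  shows "\<exists>u'\<in>V. card (separators E v u' \<inter> F) = j"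
  using assms(3,4)
proof (induction rule: rtrancl_induct)
  case base
  then show ?case using assms(2) by (intro bexI[of _ v]) (auto simp: separators_self)
next
  case (step y z)
  have "separators E v z \<subseteq> insert {y, z} (separators E v y)"
  proof
    fix f assume f: "f \<in> separators E v z"
    show "f \<in> insert {y, z} (separators E v y)"
    proof (rule ccontr)
      assume "f \<notin> insert {y, z} (separators E v y)"
      then have nf: "f \<noteq> {y, z}" "f \<notin> separators E v y" by simp_all
      have "f \<in> E" "\<not> reach (E - {f}) v z" using f by (simp_all add: separators_def)
      moreover from this nf have "reach (E - {f}) v y" by (simp add: separators_def)
      moreover have "reach (E - {f}) y z" using nf(1) step.hyps(2) by (intro reach_edge) simp
      ultimately show False by (meson rtrancl_trans)
    qed
  qed
  then have "card (separators E v z \<inter> F) \<le> card (insert {y, z} (separators E v y \<inter> F))"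
    using graph_on_finite[OF assms(1)] by (intro card_mono) (auto simp: separators_def)
  also have "\<dots> \<le> Suc (card (separators E v y \<inter> F))" by (rule card_insert_le_m1) auto
  finally have le: "card (separators E v z \<inter> F) \<le> Suc (card (separators E v y \<inter> F))" .
  show ?case
  proof (cases "j = card (separators E v z \<inter> F)")
    case True
    moreover have "z \<in> V" using step.hyps graph_on_edge[OF assms(1)] by simp
    ultimately show ?thesis by blast
  next
    case False
    then show ?thesis using le step.IH step.prems by simp
  qed
qed

text \<open>All \<open>k\<close> separators of \<open>v\<close> and \<open>w\<close> lose their
  effect. The number of them between \<open>v\<close> and a vertex takes every value
  \<open>0, ..., k\<close>, so the total drops by at least \<open>0 + 1 + ... + k\<close>; doubling
  avoids a division by 2.\<close>

lemma total_relevance_insert: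
  assumes "graph_on V E" "connects E V" "v \<in> V" "w \<in> V" "{v, w} \<notin> E"
    and k: "k = card (separators E v w)"
  shows "2 * total_relevance V (insert {v, w} E) v + k * (k + 1) \<le> 2 * total_relevance V E v"
proof -
  let ?F = "separators E v w"
  let ?h = "\<lambda>u. card (separators E v u \<inter> ?F)"
  have finV: "finite V" and finE: "finite E"
    using assms graph_on_finite by (auto simp: graph_on_def)
  have fin: "finite (separators E v u)" for u using finE by (simp add: separators_def)
  have "card (separators (insert {v, w} E) v u) + ?h u \<le> card (separators E v u)" if "u \<in> V" for u
  proof -
    let ?A = "separators (insert {v, w} E) v u"
    have "?A \<subseteq> separators E v u" using assms that by (intro separators_insert_subset) auto
    moreover have "?A \<inter> (separators E v u \<inter> ?F) = {}"
      using separators_insert_disjoint[OF assms(1-4) that assms(5)] by auto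
    ultimately show ?thesis
      using fin by (subst card_Un_disjoint[symmetric]) (auto intro!: card_mono dest: finite_subset)
  qed
  then have "(\<Sum>u\<in>V. card (separators (insert {v, w} E) v u) + ?h u) \<le> total_relevance V E v"
    unfolding total_relevance_def by (intro sum_mono)
  then have *: "total_relevance V (insert {v, w} E) v + (\<Sum>u\<in>V. ?h u) \<le> total_relevance V E v"
    by (simp add: total_relevance_def sum.distrib)
  have "{0..k} \<subseteq> ?h ` V"
  proof
    fix j assume "j \<in> {0..k}"
    moreover have "reach E v w" using assms by (simp add: connects_def)
    ultimately show "j \<in> ?h ` V"
      using separators_intermediate[OF assms(1,3), of w j ?F] k by auto
  qed
  then have "\<Sum>{0..k} \<le> \<Sum>(?h ` V)" using finV by (intro sum_mono2) auto
  \<comment> \<open>Passing to the image only drops repeated values of \<open>?h\<close>.\<close>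
  also have "\<dots> \<le> (\<Sum>u\<in>V. ?h u)" using sum_image_le[OF finV, of "\<lambda>x. x" ?h] by (simp add: o_def)
  finally have "k * (k + 1) \<le> 2 * (\<Sum>u\<in>V. ?h u)"
    using double_gauss_sum[of k, where 'a = nat] by simp
  with * show ?thesis by simp
qed

text \<open>Stability against additions speaks only of pairs not yet joined. An adjacent pair has at
  most one separator, its own edge, and that edge cuts off any third vertex from one of the two
  endpoints.\<close>

lemma ex_separated_nonadjacent:
  assumes "graph_on V E" "connects E V" "card V \<ge> 3" "v \<in> V" "w \<in> V" "separators E v w \<noteq> {}"
  shows "\<exists>v'\<in>V. \<exists>w'\<in>V. v' \<noteq> w' \<and> {v', w'} \<notin> E \<and>
    card (separators E v w) \<le> card (separators E v' w')"
proof (cases "{v, w} \<in> E")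
  case False
  moreover have "v \<noteq> w" using assms(6) by (auto simp: separators_self)
  ultimately show ?thesis using assms by blast
next
  case True
  let ?f = "{v, w}"
  have sep: "separators E v w = {?f}" using separators_edge[OF True] assms(6) by auto
  then have nr: "\<not> reach (E - {?f}) v w" by (auto simp: separators_def)
  have "\<not> V \<subseteq> ?f"
  proof
    assume "V \<subseteq> ?f"
    then have "card V \<le> card ?f" by (intro card_mono) auto
    also have "\<dots> \<le> 2" by (simp add: card_insert_if)
    finally show False using assms(3) by simp
  qed
  then obtain u where u: "u \<in> V" "u \<noteq> v" "u \<noteq> w" by auto
  have *: ?thesis if "\<not> reach (E - {?f}) u z" "z \<in> {v, w}" for z
  proof -
    have "{u, z} \<notin> E"
    proof
      assume "{u, z} \<in> E"
      then have "reach (E - {?f}) u z" using u by (intro reach_edge) auto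
      then show False using that by simp
    qed
    moreover have "1 \<le> card (separators E u z)"
      using that True graph_on_finite[OF assms(1)]
      by (auto simp: separators_def Suc_le_eq card_gt_0_iff)
    moreover have "z \<in> V" "u \<noteq> z" using that(2) u assms(4,5) by auto
    moreover have "card (separators E v w) = 1" using sep by simp
    ultimately show ?thesis using u(1) by (intro bexI[of _ u] bexI[of _ z] conjI) simp_all
  qed
  have "\<not> reach (E - {?f}) u v \<or> \<not> reach (E - {?f}) u w"
    using nr by (meson reach_sym rtrancl_trans)
  then show ?thesis using *[of v] *[of w] by auto
qed


subsection \<open>Counting edges\<close>

text \<open>Every vertex has an incident edge, and an edge covers two vertices.\<close>

lemma card_le_twice_edges:
  assumes "graph_on V E" "connects E V" "card V \<ge> 2"
  shows "card V \<le> 2 * card E"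
proof -
  have "V \<subseteq> \<Union>E"
  proof
    fix v assume v: "v \<in> V"
    have "\<not> V \<subseteq> {v}"
    proof
      assume "V \<subseteq> {v}"
      then have "card V \<le> card {v}" by (intro card_mono) simp_all
      then show False using assms(3) by simp
    qed
    then obtain w where "w \<in> V" "w \<noteq> v" by auto
    then have "reach E v w" using assms(2) v by (simp add: connects_def)
    then show "v \<in> \<Union>E" using \<open>w \<noteq> v\<close> by (cases rule: converse_rtranclE) auto
  qed
  moreover have "finite (\<Union>E)"
    by (rule finite_subset[of _ V]) (use assms(1) in \<open>auto simp: graph_on_def\<close>)
  ultimately have "card V \<le> card (\<Union>E)" by (rule card_mono[rotated])
  also have "\<dots> \<le> (\<Sum>e\<in>E. card e)" by (rule card_Union_le_sum_card)
  also have "\<dots> = (\<Sum>e\<in>E. 2)"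
  proof (rule sum.cong)
    fix e assume "e \<in> E"
    then obtain x y where "x \<noteq> y" "e = {x, y}" using graph_on_edgeE[OF assms(1)] by metis
    then show "card e = 2" by simp
  qed simp
  finally show ?thesis by simp
qed

text \<open>Starting from a root \<open>r\<close>, a connected vertex set grows by one crossing edge
  at a time; minimality is recorded as a bound on the number of edges.\<close>

lemma ex_spanning_tree:
  assumes "graph_on V E" "connects E V" "V \<noteq> {}"
  shows "\<exists>T\<subseteq>E. connects T V \<and> card T < card V"
proof -
  have finV: "finite V" using assms by (simp add: graph_on_def)
  obtain r where r: "r \<in> V" using assms by auto
  have "\<exists>A T. A \<subseteq> V \<and> r \<in> A \<and> card A = Suc k \<and> T \<subseteq> E \<and> card T \<le> k \<and> (\<forall>a\<in>A. reach T r a)"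
    if "Suc k \<le> card V" for k
    using that
  proof (induction k)
    case 0
    then show ?case using r by (intro exI[of _ "{r}"] exI[of _ "{}"]) auto
  next
    case (Suc k)
    then obtain A T where A: "A \<subseteq> V" "r \<in> A" "card A = Suc k" "T \<subseteq> E" "card T \<le> k"
      "\<forall>a\<in>A. reach T r a" by auto
    then have "A \<noteq> V" using Suc.prems by auto
    then obtain b where b: "b \<in> V" "b \<notin> A" using A(1) by blast
    have "reach E r b" using assms(2) r b by (simp add: connects_def)
    \<comment> \<open>A path from \<open>r\<close> in \<open>A\<close> to \<open>b\<close> outside
      must cross the boundary of \<open>A\<close>.\<close>
    then have "b \<in> A \<or> (\<exists>x\<in>A. \<exists>y. y \<notin> A \<and> {x, y} \<in> E)"
      by (induction rule: rtrancl_induct) (use A in auto)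
    then obtain x y where xy: "x \<in> A" "y \<notin> A" "{x, y} \<in> E" using b by auto
    then have "y \<in> V" using graph_on_edge[OF assms(1)] by auto
    let ?T = "insert {x, y} T"
    have "reach ?T r a" if "a \<in> A" for a
      using that A(6) reach_mono[of r a T ?T] by auto
    moreover from this have "reach ?T r y"
      using xy(1) reach_edge[of x y ?T] by (meson insertI1 rtrancl_trans)
    moreover have "card ?T \<le> Suc k" using A(5) card_insert_le_m1[of "Suc k" T] by simp
    moreover have "card (insert y A) = Suc (Suc k)"
      using xy A finite_subset[OF _ finV] by simp
    moreover have "insert y A \<subseteq> V" "r \<in> insert y A" "?T \<subseteq> E" using A xy \<open>y \<in> V\<close> by simp_all
    ultimately show ?case by (intro exI[of _ "insert y A"] exI[of _ ?T]) simp
  qed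
  moreover have pos: "0 < card V" using r finV by (auto simp: card_gt_0_iff)
  ultimately have "\<exists>A T. A \<subseteq> V \<and> r \<in> A \<and> card A = card V \<and> T \<subseteq> E \<and> card T \<le> card V - 1 \<and>
      (\<forall>a\<in>A. reach T r a)"
    by (metis Suc_pred' order_refl)
  then obtain A T where A: "A \<subseteq> V" "card A = card V" "T \<subseteq> E" "card T \<le> card V - 1"
    "\<forall>a\<in>A. reach T r a" by auto
  then have "A = V" using finV by (simp add: card_subset_eq)
  then have "connects T V" using A(5) unfolding connects_def by (meson reach_sym rtrancl_trans)
  moreover have "card T < card V" using A(4) pos by simp
  ultimately show ?thesis using A(3) by auto
qed

text \<open>If \<open>e \<notin> T\<close> reconnects two vertices separated by the removal of both \<open>e\<close> and \<open>f\<close>, then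
  \<open>f \<in> T\<close> and \<open>e\<close>, \<open>f\<close> are the only edges between the two sides of \<open>T - {f}\<close>; so \<open>f\<close>
  determines \<open>e\<close>.\<close>

lemma card_outside_tree_le:
  assumes "graph_on V E" "T \<subseteq> E" "connects T V"
    and crit: "\<forall>e\<in>E - T. \<exists>f\<in>E - {e}. \<exists>a\<in>V. \<exists>b\<in>V.
      reach (E - {f}) a b \<and> \<not> reach (E - {e} - {f}) a b"
  shows "card (E - T) \<le> card T"
proof -
  define P where "P e f \<longleftrightarrow> f \<in> E - {e} \<and> (\<exists>a\<in>V. \<exists>b\<in>V.
      reach (E - {f}) a b \<and> \<not> reach (E - {e} - {f}) a b)" for e f
  have "\<forall>e\<in>E - T. \<exists>f. P e f" using crit unfolding P_def by (simp only: Bex_def)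
  then obtain g where "\<And>e. e \<in> E - T \<Longrightarrow> P e (g e)" by metis
  then have g: "g e \<in> E - {e} \<and> (\<exists>a\<in>V. \<exists>b\<in>V.
      reach (E - {g e}) a b \<and> \<not> reach (E - {e} - {g e}) a b)" if "e \<in> E - T" for e
    using that by (simp only: P_def)
  have disc: "\<not> connects (E - {e} - {g e}) V" if "e \<in> E - T" for e
    using g[OF that] unfolding connects_def by metis
  have gT: "g e \<in> T" if "e \<in> E - T" for e
  proof (rule ccontr)
    assume "g e \<notin> T"
    then have "T \<subseteq> E - {e} - {g e}" using that assms(2) by auto
    then have "connects (E - {e} - {g e}) V" by (rule connects_mono[OF assms(3)])
    then show False using disc[OF that] by contradiction
  qed
  have "inj_on g (E - T)"
  proof (rule inj_onI, rule ccontr)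
    fix e e' assume e: "e \<in> E - T" "e' \<in> E - T" "g e = g e'" "e \<noteq> e'"
    obtain x y where xy: "x \<in> V" "y \<in> V" "e = {x, y}"
      using e graph_on_edgeE[OF assms(1)] by (metis DiffD1)
    \<comment> \<open>Otherwise \<open>e\<close> would be redundant in \<open>E - {g e}\<close>, and
      its removal could not separate \<open>a\<close> from \<open>b\<close>.\<close>
    have "\<not> reach (T - {g e}) x y"
    proof
      assume "reach (T - {g e}) x y"
      then have xyr: "reach (E - {e} - {g e}) x y"
        by (rule reach_mono) (use e assms(2) in auto)
      obtain a b where ab: "reach (E - {g e}) a b" "\<not> reach (E - {e} - {g e}) a b"
        using g[OF e(1)] by blast
      have "E - {g e} = insert {x, y} (E - {e} - {g e})" using xy e g[OF e(1)] by auto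
      then show False using ab reach_insert_redundant[OF _ xyr] by simp
    qed
    \<comment> \<open>So \<open>e\<close> repairs \<open>T - {g e}\<close>. As \<open>e\<close>
      survives the removal of \<open>e'\<close> and of \<open>g e' = g e\<close>, this contradicts
      \<open>disc\<close> for \<open>e'\<close>.\<close>
    then have "connects (insert {x, y} (T - {g e})) V"
      by (intro connects_exchange[OF graph_on_subset[OF assms(1,2)] assms(3) xy(1,2)])
    moreover have "insert {x, y} (T - {g e}) \<subseteq> E - {e'} - {g e'}"
      using xy e assms(2) g[OF e(1)] by auto
    ultimately have "connects (E - {e'} - {g e'}) V" by (rule connects_mono)
    then show False using disc[OF e(2)] by contradiction
  qed
  then show ?thesis
  proof (rule card_inj_on_le)
    show "g ` (E - T) \<subseteq> T" using gT by blast
    show "finite T" by (rule finite_subset[OF assms(2) graph_on_finite[OF assms(1)]])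
  qed
qed


text \<open>The condition on \<open>e\<close> says that its removal creates no new separating edges.\<close>

lemma total_relevance_remove:
  assumes "graph_on V E" "v \<in> V"
    and "\<forall>f\<in>E - {e}. \<forall>a\<in>V. \<forall>b\<in>V. reach (E - {f}) a b \<longrightarrow> reach (E - {e} - {f}) a b"
  shows "total_relevance V (E - {e}) v \<le> total_relevance V E v"
  unfolding total_relevance_def
proof (intro sum_mono card_mono)
  fix w assume w: "w \<in> V"
  show "finite (separators E v w)" using graph_on_finite[OF assms(1)] by (simp add: separators_def)
  show "separators (E - {e}) v w \<subseteq> separators E v w"
  proof
    fix f assume "f \<in> separators (E - {e}) v w"
    then have "f \<in> E - {e}" "\<not> reach (E - {e} - {f}) v w" by (simp_all add: separators_def)
    then show "f \<in> separators E v w" using assms(2,3) w unfolding separators_def by auto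
  qed
qed


subsection \<open>The game\<close>

lemma final_edges_iff: "{v, w} \<in> final_edges S \<longleftrightarrow> S v w \<and> S w v"
  by (auto simp: final_edges_def doubleton_eq_iff)

lemma graph_on_final_edges:
  assumes "strategy_profile n S"
  shows "graph_on (players n) (final_edges S)"
  unfolding graph_on_def
proof (intro conjI ballI)
  fix e assume "e \<in> final_edges S"
  then obtain x y where "e = {x, y}" "S x y" by (auto simp: final_edges_def)
  then show "\<exists>x\<in>players n. \<exists>y\<in>players n. x \<noteq> y \<and> e = {x, y}"
    using assms unfolding strategy_profile_def by metis
qed (simp add: players_def)

lemma final_edges_eqI:
  assumes "\<And>x y. {x, y} \<in> F \<longleftrightarrow> S x y \<and> S y x" "\<And>e. e \<in> F \<Longrightarrow> \<exists>x y. e = {x, y}"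
  shows "final_edges S = F"
proof (rule set_eqI)
  fix e
  show "e \<in> final_edges S \<longleftrightarrow> e \<in> F"
  proof (cases "\<exists>x y. e = {x, y}")
    case True
    then show ?thesis using assms(1) by (auto simp: final_edges_iff)
  next
    case False
    then show ?thesis using assms(2) unfolding final_edges_def by blast
  qed
qed

lemma final_edges_doubleton: "e \<in> final_edges S \<Longrightarrow> \<exists>x y. e = {x, y}"
  unfolding final_edges_def by blast

lemma final_edges_add:
  assumes "v \<noteq> w"
  shows "final_edges (add_request (add_request S v w) w v) = insert {v, w} (final_edges S)"
proof (rule final_edges_eqI)
  show "{x, y} \<in> insert {v, w} (final_edges S) \<longleftrightarrow>
      add_request (add_request S v w) w v x y \<and> add_request (add_request S v w) w v y x" for x y
    using assms by (simp add: final_edges_iff doubleton_eq_iff add_request_def)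
  show "\<exists>x y. e = {x, y}" if "e \<in> insert {v, w} (final_edges S)" for e
    using that final_edges_doubleton by blast
qed

lemma final_edges_del: "final_edges (del_request S v w) = final_edges S - {{v, w}}"
proof (rule final_edges_eqI)
  show "{x, y} \<in> final_edges S - {{v, w}} \<longleftrightarrow> del_request S v w x y \<and> del_request S v w y x" for x y
    by (simp add: final_edges_iff doubleton_eq_iff del_request_def)
  show "\<exists>x y. e = {x, y}" if "e \<in> final_edges S - {{v, w}}" for e
    using that final_edges_doubleton by blast
qed

lemma strategy_profile_add:
  "strategy_profile n S \<Longrightarrow> v \<in> players n \<Longrightarrow> w \<in> players n \<Longrightarrow> v \<noteq> w \<Longrightarrow>
    strategy_profile n (add_request (add_request S v w) w v)"
  by (auto simp: strategy_profile_def add_request_def)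

lemma strategy_profile_del: "strategy_profile n S \<Longrightarrow> strategy_profile n (del_request S v w)"
  by (auto simp: strategy_profile_def del_request_def)

text \<open>Counted from \<open>S\<close> and not from the final graph, because a request is paid
  for even when it is not answered, as can happen after a unilateral deletion.\<close>

definition num_requests :: "nat \<Rightarrow> profile \<Rightarrow> nat \<Rightarrow> nat" where
  "num_requests n S v = card {w \<in> players n. S v w}"

lemma finite_players [simp]: "finite (players n)"
  by (simp add: players_def)

lemma card_players [simp]: "card (players n) = n"
  by (simp add: players_def)

lemma individual_cost_alt:
  "individual_cost n \<alpha> S v =
    ereal (\<alpha> * num_requests n S v) + disconnection_cost (players n) (final_edges S) v"
  by (simp add: individual_cost_def num_requests_def Int_def)

lemma individual_cost_connected:
  fixes \<alpha> :: real
  assumes "strategy_profile n S" "connects (final_edges S) (players n)" "v \<in> players n"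
  shows "individual_cost n \<alpha> S v = ereal (\<alpha> * num_requests n S v +
    total_relevance (players n) (final_edges S) v / card (final_edges S))"
  using disconnection_cost_connected[OF graph_on_final_edges[OF assms(1)] assms(2,3)]
  by (simp add: individual_cost_alt)

lemma individual_cost_disconnected:
  fixes \<alpha> :: real
  assumes "strategy_profile n S" "\<not> connects (final_edges S) (players n)"
  shows "individual_cost n \<alpha> S v = \<infinity>"
  using disconnection_cost_disconnected[OF graph_on_final_edges[OF assms(1)] assms(2)]
  by (simp add: individual_cost_alt)

lemma num_requests_add:
  assumes "\<not> S v w" "w \<in> players n" "v \<noteq> w"
  shows "num_requests n (add_request (add_request S v w) w v) v = Suc (num_requests n S v)"
proof -
  have "{u \<in> players n. add_request (add_request S v w) w v v u} = insert w {u \<in> players n. S v u}"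
    using assms by (auto simp: add_request_def)
  then show ?thesis using assms(1) by (simp add: num_requests_def)
qed

lemma num_requests_del:
  assumes "S v w" "w \<in> players n"
  shows "num_requests n S v = Suc (num_requests n (del_request S v w) v)"
proof -
  have "{u \<in> players n. S v u} = insert w {u \<in> players n. del_request S v w v u}"
    using assms by (auto simp: del_request_def)
  then show ?thesis by (simp add: num_requests_def) (simp add: del_request_def)
qed

text \<open>Every request lies over a final edge because \<open>S\<close> is essential, and a final
  edge has only two orientations.\<close>

lemma sum_num_requests_le:
  assumes "strategy_profile n S" "essential S"
  shows "(\<Sum>v\<in>players n. num_requests n S v) \<le> 2 * card (final_edges S)"
proof -
  let ?P = "SIGMA v:players n. {w \<in> players n. S v w}"
  have g: "graph_on (players n) (final_edges S)" by (rule graph_on_final_edges[OF assms(1)])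
  have fin: "finite {(v, w). {v, w} = e}" if "e \<in> final_edges S" for e
    using that by (rule graph_on_edgeE[OF g])
      (auto intro: finite_subset[of _ "e \<times> e"])
  have "(\<Sum>v\<in>players n. num_requests n S v) = card ?P"
    by (simp add: num_requests_def)
  also have "\<dots> \<le> card (\<Union>e\<in>final_edges S. {(v, w). {v, w} = e})"
  proof (rule card_mono)
    show "finite (\<Union>e\<in>final_edges S. {(v, w). {v, w} = e})"
      using graph_on_finite[OF g] fin by blast
    show "?P \<subseteq> (\<Union>e\<in>final_edges S. {(v, w). {v, w} = e})"
      using assms(2) by (auto simp: final_edges_iff essential_def)
  qed
  also have "\<dots> \<le> (\<Sum>e\<in>final_edges S. card {(v, w). {v, w} = e})"
    by (rule card_UN_le) (rule graph_on_finite[OF g])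
  also have "\<dots> \<le> (\<Sum>e\<in>final_edges S. 2)"
  proof (rule sum_mono)
    fix e assume "e \<in> final_edges S"
    then obtain x y where "x \<noteq> y" "e = {x, y}" using graph_on_edgeE[OF g] by metis
    then have "{(v, w). {v, w} = e} \<subseteq> {(x, y), (y, x)}" by (auto simp: doubleton_eq_iff)
    then have "card {(v, w). {v, w} = e} \<le> card {(x, y), (y, x)}" by (intro card_mono) auto
    then show "card {(v, w). {v, w} = e} \<le> 2" by (simp add: card_insert_if split: if_splits)
  qed
  finally show ?thesis by simp
qed

section \<open>Lower bound for the optimum\<close>

text \<open>In a connected graph every player has a neighbour and so pays for at least one request;
  otherwise the cost is infinite.\<close>

lemma social_cost_ge:
  fixes \<alpha> :: real
  assumes "n \<ge> 2" "\<alpha> > 0" "strategy_profile n S"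
  shows "social_cost n \<alpha> S \<ge> ereal (\<alpha> * n)"
proof (cases "connects (final_edges S) (players n)")
  case True
  have req: "1 \<le> num_requests n S v" if v: "v \<in> players n" for v
  proof -
    have "\<not> players n \<subseteq> {v}"
    proof
      assume "players n \<subseteq> {v}"
      then have "card (players n) \<le> card {v}" by (intro card_mono) simp_all
      then show False using assms(1) by simp
    qed
    then obtain w where w: "w \<in> players n" "w \<noteq> v" by auto
    then have "reach (final_edges S) v w" using True v by (simp add: connects_def)
    then obtain u where "{v, u} \<in> final_edges S"
      using w(2) by (cases rule: converse_rtranclE) auto
    then have "S v u" "u \<in> players n"
      using assms(3) by (auto simp: final_edges_iff strategy_profile_def)
    then show ?thesis by (auto simp: num_requests_def Suc_le_eq card_gt_0_iff)
  qed
  have "ereal (\<alpha> * n) = (\<Sum>v\<in>players n. ereal \<alpha>)" by (simp add: mult.commute)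
  also have "\<dots> \<le> social_cost n \<alpha> S"
    unfolding social_cost_def
  proof (rule sum_mono)
    fix v assume v: "v \<in> players n"
    have "\<alpha> * 1 \<le> \<alpha> * num_requests n S v"
      using req[OF v] assms(2) by (intro mult_left_mono) simp_all
    then have "\<alpha> \<le> \<alpha> * num_requests n S v +
        total_relevance (players n) (final_edges S) v / card (final_edges S)"
      by (intro add_increasing2) simp_all
    then show "ereal \<alpha> \<le> individual_cost n \<alpha> S v"
      unfolding individual_cost_connected[OF assms(3) True v] by simp
  qed
  finally show ?thesis .
next
  case False
  have "1 \<in> players n" using assms(1) by (simp add: players_def)
  then have "social_cost n \<alpha> S = \<infinity>"
    using individual_cost_disconnected[OF assms(3) False] finite_players
    unfolding social_cost_def sum_Pinfty by blast
  then show ?thesis by simp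
qed

lemma optimal_cost_ge:
  fixes \<alpha> :: real
  assumes "n \<ge> 2" "\<alpha> > 0"
  shows "optimal_cost n \<alpha> \<ge> ereal (\<alpha> * n)"
  unfolding optimal_cost_def
  using social_cost_ge[OF assms] Min_in[OF finite_social_costs social_costs_nonempty, of n \<alpha>] by auto

section \<open>Consequences of pairwise stability\<close>

text \<open>In a disconnected graph every player already has infinite cost, so both endpoints of a
  missing edge would accept it, whether or not it restores connectivity.\<close>

lemma pairwise_stable_connected:
  fixes \<alpha> :: real
  assumes "n \<ge> 3" "pairwise_stable n \<alpha> S"
  shows "connects (final_edges S) (players n)"
proof (rule ccontr)
  assume nc: "\<not> connects (final_edges S) (players n)"
  then obtain v w where vw: "v \<in> players n" "w \<in> players n" "\<not> reach (final_edges S) v w"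
    by (auto simp: connects_def)
  then have "v \<noteq> w" "{v, w} \<notin> final_edges S" using reach_edge[of v w "final_edges S"] by auto
  then have "individual_cost n \<alpha> (add_request (add_request S v w) w v) v \<le> individual_cost n \<alpha> S v \<longrightarrow>
      individual_cost n \<alpha> S w < individual_cost n \<alpha> (add_request (add_request S v w) w v) w"
    using assms(2) vw(1,2) unfolding pairwise_stable_def by blast
  moreover have "strategy_profile n S" using assms(2) by (simp add: pairwise_stable_def)
  ultimately show False by (simp add: individual_cost_disconnected[OF _ nc])
qed

text \<open>With \<open>k\<close> separators and \<open>m\<close> edges, a new edge costs each
  endpoint \<alpha> and lowers its disconnection cost by at least
  \<open>k * (k + 1) / (2 * m)\<close>; both endpoints gain this because \<open>separators\<close>
  is symmetric.\<close>

lemma pairwise_stable_separators: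
  fixes \<alpha> :: real
  assumes n: "n \<ge> 3" and \<alpha>: "\<alpha> > 0" and st: "pairwise_stable n \<alpha> S"
    and vw: "v \<in> players n" "w \<in> players n"
  shows "(real (card (separators (final_edges S) v w)))\<^sup>2 \<le> 2 * \<alpha> * card (final_edges S)"
proof (cases "separators (final_edges S) v w = {}")
  case True
  then show ?thesis using \<alpha> by simp
next
  case False
  let ?V = "players n" and ?E = "final_edges S"
  let ?m = "real (card ?E)"
  have sp: "strategy_profile n S" using st by (simp add: pairwise_stable_def)
  have g: "graph_on ?V ?E" by (rule graph_on_final_edges[OF sp])
  have c: "connects ?E ?V" by (rule pairwise_stable_connected[OF n st])
  have m: "?m > 0" using card_le_twice_edges[OF g c] n by simp
  obtain x y where xy: "x \<in> ?V" "y \<in> ?V" "x \<noteq> y" "{x, y} \<notin> ?E"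
    and le: "card (separators ?E v w) \<le> card (separators ?E x y)"
    using ex_separated_nonadjacent[OF g c _ vw False] n by auto
  define k where "k = card (separators ?E x y)"
  \<comment> \<open>Weak improvement suffices: stability forbids an addition that leaves neither
    endpoint worse off. Generic \<open>a\<close> and \<open>b\<close> cover both endpoints.\<close>
  have improves: "individual_cost n \<alpha> (add_request (add_request S a b) b a) a \<le> individual_cost n \<alpha> S a"
    if big: "2 * \<alpha> * ?m \<le> real k * (real k + 1)" and ab: "a \<in> ?V" "b \<in> ?V" "a \<noteq> b" "{a, b} \<notin> ?E"
      and k: "k = card (separators ?E a b)" for a b
  proof -
    let ?S = "add_request (add_request S a b) b a"
    let ?R = "real (total_relevance ?V ?E a)" and ?R' = "real (total_relevance ?V (insert {a, b} ?E) a)"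
    have E: "final_edges ?S = insert {a, b} ?E" by (rule final_edges_add[OF ab(3)])
    have c': "connects (final_edges ?S) ?V" unfolding E by (rule connects_mono[OF c]) auto
    have card: "card (final_edges ?S) = Suc (card ?E)"
      unfolding E using graph_on_finite[OF g] ab(4) by simp
    have "\<not> S a b" using ab(4) st by (auto simp: final_edges_iff pairwise_stable_def essential_def)
    note req = num_requests_add[where S = S and v = a and w = b, OF this ab(2,3)]
    have "real (2 * total_relevance ?V (insert {a, b} ?E) a + k * (k + 1)) \<le> real (2 * total_relevance ?V ?E a)"
      using total_relevance_insert[OF g c ab(1,2,4) k] by (rule of_nat_mono)
    then have "2 * ?R' + real k * (real k + 1) \<le> 2 * ?R" by (simp add: algebra_simps)
    then have "\<alpha> * ?m + ?R' \<le> ?R" using big by linarith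
    then have "(\<alpha> * ?m + ?R') / ?m \<le> ?R / ?m" using m by (intro divide_right_mono) auto
    then have "\<alpha> + ?R' / ?m \<le> ?R / ?m" using m by (simp add: add_divide_distrib)
    \<comment> \<open>One more edge also makes each single edge a less likely target.\<close>
    moreover have "?R' / (?m + 1) \<le> ?R' / ?m" using m by (intro divide_left_mono) auto
    ultimately have "\<alpha> + ?R' / (1 + ?m) \<le> ?R / ?m" by (simp add: add.commute)
    then show ?thesis
      unfolding individual_cost_connected[OF sp c ab(1)]
        individual_cost_connected[OF strategy_profile_add[OF sp ab(1-3)] c' ab(1)] req card
      by (simp add: E algebra_simps)
  qed
  have "real k * (real k + 1) < 2 * \<alpha> * ?m"
  proof (rule ccontr)
    assume "\<not> real k * (real k + 1) < 2 * \<alpha> * ?m"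
    then have big: "2 * \<alpha> * ?m \<le> real k * (real k + 1)" by simp
    have "add_request (add_request S y x) x y = add_request (add_request S x y) y x"
      using xy(3) by (auto simp: add_request_def fun_eq_iff)
    moreover have "{y, x} \<notin> ?E" using xy(4) by (simp add: insert_commute)
    ultimately have "individual_cost n \<alpha> (add_request (add_request S x y) y x) y \<le> individual_cost n \<alpha> S y"
      using improves[OF big xy(2,1) _ _ ] xy(3) separators_sym[of ?E x y] by (metis k_def)
    moreover have "individual_cost n \<alpha> (add_request (add_request S x y) y x) x \<le> individual_cost n \<alpha> S x"
      by (rule improves[OF big xy k_def])
    ultimately show False using st xy unfolding pairwise_stable_def by (meson leD)
  qed
  moreover have "(real (card (separators ?E v w)))\<^sup>2 \<le> real k ^ 2"
    using le by (intro power_mono) (auto simp: k_def)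
  moreover have "real k ^ 2 \<le> real k * (real k + 1)" by (simp add: power2_eq_square algebra_simps)
  ultimately show ?thesis by linarith
qed

lemma pairwise_stable_total_relevance:
  fixes \<alpha> :: real
  assumes "n \<ge> 3" "\<alpha> > 0" "pairwise_stable n \<alpha> S" "v \<in> players n"
  shows "real (total_relevance (players n) (final_edges S) v) \<le> n * sqrt (2 * \<alpha> * card (final_edges S))"
proof -
  have "real (total_relevance (players n) (final_edges S) v) =
      (\<Sum>w\<in>players n. real (card (separators (final_edges S) v w)))"
    by (simp add: total_relevance_def)
  also have "\<dots> \<le> (\<Sum>w\<in>players n. sqrt (2 * \<alpha> * card (final_edges S)))"
    by (intro sum_mono real_le_rsqrt pairwise_stable_separators[OF assms])
  finally show ?thesis by simp
qed

text \<open>Either every edge outside a spanning tree is critical in the sense of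
  \<open>card_outside_tree_le\<close>, or stability against the removal of a noncritical edge yields
  the cubic bound.\<close>

lemma pairwise_stable_card_edges:
  fixes \<alpha> :: real
  assumes n: "n \<ge> 3" and \<alpha>: "\<alpha> > 0" and st: "pairwise_stable n \<alpha> S"
  shows "card (final_edges S) \<le> 2 * n \<or> \<alpha> * real (card (final_edges S)) ^ 3 \<le> 8 * real n ^ 2"
proof -
  let ?V = "players n" and ?E = "final_edges S"
  let ?m = "real (card ?E)"
  have sp: "strategy_profile n S" using st by (simp add: pairwise_stable_def)
  have g: "graph_on ?V ?E" by (rule graph_on_final_edges[OF sp])
  have c: "connects ?E ?V" by (rule pairwise_stable_connected[OF n st])
  have "1 \<in> ?V" using n by (simp add: players_def)
  then obtain T where T: "T \<subseteq> ?E" "connects T ?V" "card T < n"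
    using ex_spanning_tree[OF g c] by auto
  have finE: "finite ?E" by (rule graph_on_finite[OF g])
  show ?thesis
  proof (cases "\<forall>e\<in>?E - T. \<exists>f\<in>?E - {e}. \<exists>a\<in>?V. \<exists>b\<in>?V.
      reach (?E - {f}) a b \<and> \<not> reach (?E - {e} - {f}) a b")
    case True
    have "card ?E = card T + card (?E - T)"
      using T(1) finE by (metis card_Diff_subset card_mono finite_subset le_add_diff_inverse)
    also have "\<dots> \<le> 2 * n" using card_outside_tree_le[OF g T(1,2) True] T(3) by simp
    finally show ?thesis ..
  next
    case False
    then obtain e where e: "e \<in> ?E" "e \<notin> T"
      and rob: "\<forall>f\<in>?E - {e}. \<forall>a\<in>?V. \<forall>b\<in>?V. reach (?E - {f}) a b \<longrightarrow> reach (?E - {e} - {f}) a b"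
      by blast
    obtain v w where vw: "v \<in> ?V" "w \<in> ?V" "e = {v, w}" using graph_on_edgeE[OF g e(1)] by metis
    let ?S = "del_request S v w"
    have E: "final_edges ?S = ?E - {e}" by (simp add: final_edges_del vw(3))
    have c': "connects (final_edges ?S) ?V"
      unfolding E by (rule connects_mono[OF T(2)]) (use T(1) e in auto)
    have m: "2 \<le> card ?E" using card_le_twice_edges[OF g c] n by simp
    have card: "real (card (final_edges ?S)) = ?m - 1"
      unfolding E using e(1) finE m by (simp add: of_nat_diff)
    have "S v w" using e(1) by (simp add: vw(3) final_edges_iff)
    note req = num_requests_del[where S = S and v = v and w = w, OF this vw(2)]
    have le: "individual_cost n \<alpha> S v \<le> individual_cost n \<alpha> ?S v"
      using st vw e(1) unfolding pairwise_stable_def by blast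
    let ?R = "real (total_relevance ?V ?E v)" and ?R' = "real (total_relevance ?V (?E - {e}) v)"
    have R: "?R' \<le> ?R" using total_relevance_remove[OF g vw(1) rob] by simp
    have "\<alpha> + ?R / ?m \<le> ?R' / (?m - 1)"
      using le unfolding individual_cost_connected[OF sp c vw(1)]
        individual_cost_connected[OF strategy_profile_del[OF sp] c' vw(1)] card req
      by (simp add: E algebra_simps)
    \<comment> \<open>No relevance total rises, so the removal can hurt only through the higher
      probability \<open>1 / (m - 1)\<close> of each remaining edge.\<close>
    also have "\<dots> \<le> ?R / (?m - 1)" using R m by (intro divide_right_mono) auto
    finally have "\<alpha> \<le> ?R / (?m - 1) - ?R / ?m" by simp
    also have "\<dots> = ?R / (?m * (?m - 1))" using m by (simp add: field_simps)
    finally have "\<alpha> * (?m * (?m - 1)) \<le> ?R" using m by (simp add: field_simps)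
    \<comment> \<open>Since \<open>m \<ge> 2\<close>, also \<open>m - 1 \<ge> m / 2\<close>.\<close>
    moreover have "\<alpha> * (?m\<^sup>2 / 2) \<le> \<alpha> * (?m * (?m - 1))"
      using \<alpha> m by (intro mult_left_mono) (auto simp: power2_eq_square field_simps)
    moreover have "?R \<le> n * sqrt (2 * \<alpha> * ?m)" by (rule pairwise_stable_total_relevance[OF n \<alpha> st vw(1)])
    ultimately have "\<alpha> * ?m\<^sup>2 \<le> 2 * n * sqrt (2 * \<alpha> * ?m)" by linarith
    \<comment> \<open>Squaring removes the root and produces \<open>8 = 4 * 2\<close>; the common
      factor \<open>\<alpha> * m\<close> then cancels.\<close>
    then have "(\<alpha> * ?m\<^sup>2)\<^sup>2 \<le> (2 * n * sqrt (2 * \<alpha> * ?m))\<^sup>2" using \<alpha> by (intro power_mono) auto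
    also have "\<dots> = 4 * (real n)\<^sup>2 * (2 * \<alpha> * ?m)" using \<alpha> by (simp add: power_mult_distrib)
    finally have "(\<alpha> * ?m) * (\<alpha> * ?m ^ 3) \<le> (\<alpha> * ?m) * (8 * real n ^ 2)"
      by (simp add: power2_eq_square power3_eq_cube algebra_simps)
    moreover have "0 < \<alpha> * ?m" using \<alpha> m by simp
    ultimately show ?thesis by (metis mult_le_cancel_left_pos)
  qed
qed

section \<open>The price of anarchy\<close>

text \<open>The factor \<open>\<alpha> * n\<close> is split off because it is the lower bound for
  the optimum. The first summand pays for the edges, the second bounds the disconnection
  costs.\<close>

lemma pairwise_stable_social_cost:
  fixes \<alpha> :: real
  assumes n: "n \<ge> 3" and \<alpha>: "\<alpha> > 0" and st: "pairwise_stable n \<alpha> S"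
  shows "social_cost n \<alpha> S \<le>
    ereal (\<alpha> * n * (2 * card (final_edges S) / n + 2 * sqrt (n / \<alpha>)))"
proof -
  let ?V = "players n" and ?E = "final_edges S"
  let ?m = "real (card ?E)" and ?R = "\<lambda>v. real (total_relevance (players n) (final_edges S) v)"
  have sp: "strategy_profile n S" using st by (simp add: pairwise_stable_def)
  have g: "graph_on ?V ?E" by (rule graph_on_final_edges[OF sp])
  have c: "connects ?E ?V" by (rule pairwise_stable_connected[OF n st])
  have m2: "n \<le> 2 * ?m" using card_le_twice_edges[OF g c] n by simp
  then have m: "?m > 0" using n by simp
  have "social_cost n \<alpha> S = (\<Sum>v\<in>?V. ereal (\<alpha> * num_requests n S v + ?R v / ?m))"
    unfolding social_cost_def by (intro sum.cong refl individual_cost_connected[OF sp c])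
  also have "\<dots> = ereal (\<alpha> * real (\<Sum>v\<in>?V. num_requests n S v) + (\<Sum>v\<in>?V. ?R v) / ?m)"
    by (simp add: sum.distrib sum_distrib_left sum_divide_distrib)
  also have "\<dots> \<le> ereal (\<alpha> * (2 * ?m) + n * (n * sqrt (2 * \<alpha> * ?m)) / ?m)"
  proof -
    have "real (\<Sum>v\<in>?V. num_requests n S v) \<le> real (2 * card ?E)"
      by (intro of_nat_mono sum_num_requests_le[OF sp]) (use st in \<open>simp add: pairwise_stable_def\<close>)
    moreover have "(\<Sum>v\<in>?V. ?R v) \<le> (\<Sum>v\<in>?V. n * sqrt (2 * \<alpha> * ?m))"
      by (intro sum_mono pairwise_stable_total_relevance[OF n \<alpha> st])
    ultimately show ?thesis
      using \<alpha> unfolding ereal_less_eq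
      by (intro add_mono mult_left_mono divide_right_mono) simp_all
  qed
  also have "\<dots> \<le> ereal (\<alpha> * n * (2 * ?m / n + 2 * sqrt (n / \<alpha>)))"
  proof -
    \<comment> \<open>Here \<open>m \<ge> n / 2\<close> enters, bounding
      \<open>2 * \<alpha> / m\<close> by \<open>4 * \<alpha> / n\<close>.\<close>
    have "sqrt (2 * \<alpha> * ?m) / ?m \<le> 2 * sqrt (\<alpha> / n)"
    proof (rule power2_le_imp_le)
      have "(sqrt (2 * \<alpha> * ?m) / ?m)\<^sup>2 = 2 * \<alpha> / ?m"
        using \<alpha> m by (simp add: power_divide) (simp add: power2_eq_square)
      also have "\<dots> \<le> 4 * \<alpha> / n" using \<alpha> m m2 n by (simp add: field_simps)
      also have "\<dots> = (2 * sqrt (\<alpha> / n))\<^sup>2" using \<alpha> by (simp add: power_mult_distrib)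
      finally show "(sqrt (2 * \<alpha> * ?m) / ?m)\<^sup>2 \<le> (2 * sqrt (\<alpha> / n))\<^sup>2" .
    qed (use \<alpha> in simp)
    then have "(real n * real n) * (sqrt (2 * \<alpha> * ?m) / ?m) \<le> (real n * real n) * (2 * sqrt (\<alpha> / n))"
      by (intro mult_left_mono) simp_all
    also have "\<dots> = \<alpha> * n * (2 * sqrt (n / \<alpha>))"
    proof -
      have "\<alpha> = sqrt \<alpha> * sqrt \<alpha>" "real n = sqrt n * sqrt n" using \<alpha> by simp_all
      then show ?thesis using \<alpha> n by (simp add: real_sqrt_divide field_simps)
    qed
    finally have "n * (n * sqrt (2 * \<alpha> * ?m)) / ?m \<le> \<alpha> * n * (2 * sqrt (n / \<alpha>))" by simp
    moreover have "\<alpha> * (2 * ?m) = \<alpha> * n * (2 * ?m / n)" using n by simp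
    ultimately show ?thesis unfolding ereal_less_eq distrib_left by linarith
  qed
  finally show ?thesis by simp
qed

text \<open>The parameter \<open>t\<close> serves both ranges of \<alpha>: it becomes
  \<open>sqrt (n / \<alpha>)\<close> in one and \<open>sqrt (n / \<alpha> powr 1.5)\<close> in the
  other.\<close>

lemma pairwise_stable_ratio:
  fixes \<alpha> t :: real
  assumes n: "n \<ge> 3" and \<alpha>: "\<alpha> > 0" and st: "pairwise_stable n \<alpha> S"
    and t: "sqrt (n / \<alpha>) \<le> t" and m: "card (final_edges S) \<le> n * (3 + 2 * t)"
  shows "social_cost n \<alpha> S / optimal_cost n \<alpha> \<le> ereal (6 * (1 + t))"
proof -
  have "2 * card (final_edges S) / n \<le> 2 * (3 + 2 * t)" using m n by (simp add: field_simps)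
  \<comment> \<open>The constant 6 arises from \<open>2 * (3 + 2 * t) + 2 * t\<close>.\<close>
  then have "\<alpha> * n * (2 * card (final_edges S) / n + 2 * sqrt (n / \<alpha>)) \<le> \<alpha> * n * (6 * (1 + t))"
    using t \<alpha> by (intro mult_left_mono) auto
  then have *: "social_cost n \<alpha> S \<le> ereal (\<alpha> * n * (6 * (1 + t)))"
    using pairwise_stable_social_cost[OF n \<alpha> st] by (meson ereal_less_eq(3) order_trans)
  have "0 \<le> sqrt (n / \<alpha>)" using \<alpha> by simp
  with t have "0 \<le> t" by (rule order_trans[rotated])
  then have pos: "0 < \<alpha> * n" "0 \<le> t" using \<alpha> n by simp_all
  have opt: "ereal (\<alpha> * n) \<le> optimal_cost n \<alpha>" using n by (intro optimal_cost_ge[OF _ \<alpha>]) simp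
  show ?thesis
  proof (cases "optimal_cost n \<alpha>")
    case (real r)
    then have r: "\<alpha> * n \<le> r" using opt by simp
    have "social_cost n \<alpha> S \<le> ereal (r * (6 * (1 + t)))"
      using * r pos(2) by (elim order_trans) (simp add: mult_right_mono)
    then show ?thesis unfolding real using r pos
      by (subst ereal_divide_le_pos) auto
  next
    \<comment> \<open>Division by \<infinity> yields 0 in \<open>ereal\<close>.\<close>
    case PInf
    then show ?thesis using pos(2) by simp
  next
    case MInf
    then show ?thesis using opt by simp
  qed
qed

theorem theorem10p8:
  shows "\<exists>c::real. c > 0 \<and>
    (\<forall>(n::nat) (\<alpha>::real) S. n \<ge> 3 \<longrightarrow> \<alpha> > 0 \<longrightarrow> pairwise_stable n \<alpha> S \<longrightarrow>
      (\<alpha> > 1 / 2 \<longrightarrow>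
        social_cost n \<alpha> S / optimal_cost n \<alpha> \<le> ereal (c * (1 + sqrt (real n / \<alpha>)))) \<and>
      (\<alpha> \<le> 1 / 2 \<longrightarrow>
        social_cost n \<alpha> S / optimal_cost n \<alpha> \<le> ereal (c * (1 + sqrt (real n / \<alpha> powr 1.5)))))"
proof (intro exI[of _ 6] conjI allI impI)
  fix n :: nat and \<alpha> :: real and S
  assume n: "n \<ge> 3" and \<alpha>: "\<alpha> > 0" and st: "pairwise_stable n \<alpha> S"
  let ?m = "real (card (final_edges S))"
  have edges: "?m \<le> 2 * n \<or> \<alpha> * ?m ^ 3 \<le> 8 * real n ^ 2"
    using pairwise_stable_card_edges[OF n \<alpha> st] by linarith
  {
    assume a: "\<alpha> > 1 / 2"
    have "?m \<le> n * 3"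
    proof (cases "?m \<le> 2 * n")
      case False
      have "1 / 2 * ?m ^ 3 \<le> \<alpha> * ?m ^ 3" using a by (intro mult_right_mono) auto
      then have "?m ^ 3 \<le> 16 * (real n)\<^sup>2" using edges False by linarith
      \<comment> \<open>The target is the cube of \<open>3 * n\<close>, reached because
        \<open>16 \<le> 27 * n\<close>.\<close>
      also have "\<dots> \<le> (9 * real n) * (3 * (real n)\<^sup>2)"
        using n by (simp add: power2_eq_square)
      also have "\<dots> = (n * 3) ^ 3" by (simp add: power2_eq_square power3_eq_cube)
      finally show ?thesis using power_mono_iff[of ?m "n * 3" 3] by simp
    qed simp
    moreover have "0 \<le> sqrt (n / \<alpha>)" using \<alpha> by simp
    then have "real n * 3 \<le> n * (3 + 2 * sqrt (n / \<alpha>))" by (intro mult_left_mono) auto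
    ultimately show "social_cost n \<alpha> S / optimal_cost n \<alpha> \<le> ereal (6 * (1 + sqrt (real n / \<alpha>)))"
      by (intro pairwise_stable_ratio[OF n \<alpha> st]) auto
  next
    assume a: "\<alpha> \<le> 1 / 2"
    define t where "t = sqrt (n / \<alpha> powr 1.5)"
    \<comment> \<open>For \<alpha> below 1 the larger exponent gives the smaller power, so
      \<open>t\<close> dominates \<open>sqrt (n / \<alpha>)\<close>.\<close>
    have p: "\<alpha> powr 1.5 \<le> \<alpha>" using \<alpha> a powr_mono'[of 1 "1.5" \<alpha>] by simp
    have p0: "0 < \<alpha> powr 1.5" using \<alpha> by simp
    have le: "n / \<alpha> \<le> n / \<alpha> powr 1.5" using p p0 \<alpha> by (intro divide_left_mono) auto
    have t2: "t\<^sup>2 = n / \<alpha> powr 1.5" using p0 by (simp add: t_def)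
    have "1 \<le> n / \<alpha>" using n \<alpha> a by (simp add: field_simps)
    then have t1: "1 \<le> t" using le by (simp add: t_def)
    have "?m \<le> n * (3 + 2 * t)"
    proof (cases "?m \<le> 2 * n")
      case True
      moreover have "real n * 2 \<le> n * (3 + 2 * t)" using t1 by (intro mult_left_mono) auto
      ultimately show ?thesis by simp
    next
      case False
      then have "\<alpha> * ?m ^ 3 \<le> 8 * (real n)\<^sup>2" using edges by simp
      then have "?m ^ 3 \<le> 8 * (n * (n / \<alpha>))" using \<alpha> by (simp add: field_simps power2_eq_square)
      also have "\<dots> \<le> 8 * (n * t\<^sup>2)" using le t2 by (intro mult_left_mono) auto
      \<comment> \<open>Both \<open>n\<close> and \<open>t\<close> are at least 1, so raising the
        exponents to 3 only enlarges the product and makes it a perfect cube.\<close>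
      also have "\<dots> \<le> 8 * (real n ^ 3 * t ^ 3)"
        using t1 n by (intro mult_left_mono mult_mono power_increasing self_le_power) auto
      also have "\<dots> = (n * (2 * t)) ^ 3" by (simp add: power_mult_distrib)
      finally have "?m \<le> n * (2 * t)" using t1 power_mono_iff[of ?m "n * (2 * t)" 3] by simp
      then show ?thesis by (simp add: distrib_left)
    qed
    then show "social_cost n \<alpha> S / optimal_cost n \<alpha> \<le> ereal (6 * (1 + sqrt (real n / \<alpha> powr 1.5)))"
      using le unfolding t_def by (intro pairwise_stable_ratio[OF n \<alpha> st]) auto
  }
qed simp

end
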